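(* Consider the generation expansion planning (GEP) game with consistent price conjectures. Consider the problem $\mathbb{P}^2$ for this game: maximize $$\sum_{i=1}^{N}\Bigl(\sum_{t=1}^{T}\bigl[P_{ti}\,x_{oti}+MCP_{ti}\,e_{ti}+RTP_{ti}\,r_{ti}\bigr]-\Bigl[C_i(x_{ci})+\sum_{t=1}^{T}F_i(e_{ti}+r_{ti})\Bigr]\Bigr)$$ over all $(x_{ci},x_{oti},e_{ti},r_{ti},P_{ti},MCP_{ti},RTP_{ti})_{t=1,\dots,T;\ i=1,\dots,N}\in\mathcal{F}^2$. A maximizer of $\mathbb{P}^2$ is an equilibrium of the GEP game with consistent price conjectures.
   Context: There are $N$ generation companies, $\mathcal{N}=\{1,\dots,N\}$, and times $t=1,\dots,T$. Company $i$ chooses real decision variables $x_{ci}$ (plant capacity), and for each $t$: $x_{oti}$ (operating reserve), $e_{ti}$ (energy-market quantity), $r_{ti}$ (real-time-market quantity); it also conjectures real prices $P_{ti}$, $MCP_{ti}$, $RTP_{ti}$ for each $t$ (operating reserve price, energy price, real-time price). Data: cost functions $C_i,F_i:\mathbb{R}\to\mathbb{R}$ (annualized capital investment cost and production cost); ramp limits $R_i^d,R_i^u\in\mathbb{R}$; forced outage rates $\rho_i$ and average forced outage rate $\rho$; loads $L_t$; average customer outage cost $a$; existing capacity $C_0$; equivalent load duration curve $ELDC:\mathbb{R}\to\mathbb{R}$. $MUP(\cdot)$ denotes the marginal unit price, i.e. the fuel cost of the marginal unit, the unit at which the condition in brackets is satisfied; thus for each $t$, $MUP(\sum_{i=1}^N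 e_{ti}=L_t)$ is a given real-valued function of $(e_{t1},\dots,e_{tN})$, and $MUP(\sum_{i=1}^N r_{ti}=\sum_{i=1}^N\rho_i e_{ti})$ is a given real-valued function of $(e_{t1},\dots,e_{tN},r_{t1},\dots,r_{tN})$. $\mathcal{F}^2$ is the set of all $(x_{ci},x_{oti},e_{ti},r_{ti},P_{ti},MCP_{ti},RTP_{ti})_{t,i}$ such that for all $i\in\mathcal{N}$ and all $t$: $0\le x_{oti}\le x_{ci}$; $e_{ti}\le x_{ci}-x_{oti}$; $r_{ti}\le x_{ci}-e_{ti}$; $R_i^d\le(e_{(t+1)i}+r_{(t+1)i})-(e_{ti}+r_{ti})\le R_i^u$ (for $t=1,\dots,T-1$); $P_{ti}=T(1-\rho)\,ELDC(C_0+X_{ot})\,a$ with $X_{ot}=\sum_{j=1}^N x_{otj}$; $MCP_{ti}=MUP(\sum_{j=1}^N e_{tj}=L_t)$; $RTP_{ti}=MUP(\sum_{j=1}^N r_{tj}=\sum_{j=1}^N\rho_j e_{tj})$; and $(P_{ti},MCP_{ti},RTP_{ti})=(P_{tj},MCP_{tj},RTP_{tj})$ for all $j\in\mathcal{N}$. GEP game with consistent price conjectures: given the decisions and conjectured prices of all other companies, company $i$ chooses $(x_{ci},(x_{oti},e_{ti},r_{ti},P_{ti},MCP_{ti},RTP_{ti})_{t})$ to maximize its profit $\sum_{t=1}^T[P_{ti}x_{oti}+MCP_{ti}e_{ti}+RTP_{ti}r_{ti}]-[C_i(x_{ci})+\sum_{t=1}^T F_i(e_{ti}+r_{ti})]$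 over those choices for which company $i$ satisfies its operational constraints (the four lines of inequalities above for index $i$), its conjectured prices satisfy the price relations above (for index $i$), and its conjectured prices coincide with those of all other companies. An equilibrium is a point of $\mathcal{F}^2$ such that for every $i\in\mathcal{N}$, company $i$'s component is optimal for this problem given the components of the other companies. *)

theory Defs
  imports Complex_Main
begin

text \<open>
  Companies are the elements of a finite type \<open>'i\<close> (so \<open>N = CARD('i)\<close>); times are the numbers
  \<open>1, \<dots>, T\<close>, and values of time-indexed functions at other arguments are irrelevant throughout.

  \<open>MUP_energy t l e\<close> stands for \<open>MUP(\<Sum>i. e\<^sub>t\<^sub>i = l)\<close> and
  \<open>MUP_rt t l e r\<close> for \<open>MUP(\<Sum>i. r\<^sub>t\<^sub>i = l)\<close>, both as arbitrary given functions:
  \<open>l\<close> is the right-hand side of the balance condition in brackets (the load, respectively the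
  expected outage \<open>\<Sum>i. \<rho>\<^sub>i e\<^sub>t\<^sub>i\<close>), and \<open>e\<close>, \<open>r\<close> are the quantity
  vectors at time \<open>t\<close>.
\<close>

record 'i gep_data =
  horizon :: nat  \<comment> \<open>\<open>T\<close>\<close>
  inv_cost :: "'i \<Rightarrow> real \<Rightarrow> real"  \<comment> \<open>\<open>C\<^sub>i\<close>\<close>
  prod_cost :: "'i \<Rightarrow> real \<Rightarrow> real"  \<comment> \<open>\<open>F\<^sub>i\<close>\<close>
  ramp_down :: "'i \<Rightarrow> real"  \<comment> \<open>lower limit for the (signed) change of output\<close>
  ramp_up :: "'i \<Rightarrow> real"
  outage_rate :: "'i \<Rightarrow> real"  \<comment> \<open>\<open>\<rho>\<^sub>i\<close>\<close>
  avg_outage_rate :: real  \<comment> \<open>\<open>\<rho>\<close>\<close>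
  load :: "nat \<Rightarrow> real"  \<comment> \<open>\<open>L\<^sub>t\<close>\<close>
  outage_cost :: real  \<comment> \<open>\<open>a\<close>\<close>
  existing_cap :: real  \<comment> \<open>\<open>C\<^sub>0\<close>\<close>
  ELDC :: "real \<Rightarrow> real"
  MUP_energy :: "nat \<Rightarrow> real \<Rightarrow> ('i \<Rightarrow> real) \<Rightarrow> real"
  MUP_rt :: "nat \<Rightarrow> real \<Rightarrow> ('i \<Rightarrow> real) \<Rightarrow> ('i \<Rightarrow> real) \<Rightarrow> real"

record choice =
  xc :: real
  xo :: "nat \<Rightarrow> real"
  en :: "nat \<Rightarrow> real"  \<comment> \<open>\<open>e\<close>\<close>
  rt :: "nat \<Rightarrow> real"  \<comment> \<open>\<open>r\<close>\<close>
  Pr :: "nat \<Rightarrow> real"  \<comment> \<open>\<open>P\<close>\<close>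
  MCP :: "nat \<Rightarrow> real"
  RTP :: "nat \<Rightarrow> real"

type_synonym 'i profile = "'i \<Rightarrow> choice"

definition operational :: "'i gep_data \<Rightarrow> 'i \<Rightarrow> choice \<Rightarrow> bool" where
  "operational d i s \<longleftrightarrow>
     (\<forall>t\<in>{1..horizon d}.
        0 \<le> xo s t \<and> xo s t \<le> xc s \<and>
        en s t \<le> xc s - xo s t \<and>
        rt s t \<le> xc s - en s t) \<and>
     (\<forall>t\<in>{1..<horizon d}.
        ramp_down d i \<le> (en s (t + 1) + rt s (t + 1)) - (en s t + rt s t) \<and>
        (en s (t + 1) + rt s (t + 1)) - (en s t + rt s t) \<le> ramp_up d i)"

definition price_relations :: "('i::finite) gep_data \<Rightarrow> 'i profile \<Rightarrow> 'i \<Rightarrow> bool" where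
  "price_relations d x i \<longleftrightarrow>
     (\<forall>t\<in>{1..horizon d}.
        Pr (x i) t = real (horizon d) * (1 - avg_outage_rate d)
          * ELDC d (existing_cap d + (\<Sum>j\<in>UNIV. xo (x j) t)) * outage_cost d \<and>
        MCP (x i) t = MUP_energy d t (load d t) (\<lambda>j. en (x j) t) \<and>
        RTP (x i) t = MUP_rt d t (\<Sum>j\<in>UNIV. outage_rate d j * en (x j) t)
          (\<lambda>j. en (x j) t) (\<lambda>j. rt (x j) t))"

definition consistent_prices :: "'i gep_data \<Rightarrow> 'i profile \<Rightarrow> 'i \<Rightarrow> bool" where
  "consistent_prices d x i \<longleftrightarrow>
     (\<forall>t\<in>{1..horizon d}. \<forall>j.
        (Pr (x i) t, MCP (x i) t, RTP (x i) t) = (Pr (x j) t, MCP (x j) t, RTP (x j) t))"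

definition F2 :: "('i::finite) gep_data \<Rightarrow> 'i profile set" where
  "F2 d = {x. \<forall>i. operational d i (x i) \<and> price_relations d x i \<and> consistent_prices d x i}"

definition profit :: "'i gep_data \<Rightarrow> 'i \<Rightarrow> choice \<Rightarrow> real" where
  "profit d i s =
     (\<Sum>t=1..horizon d. Pr s t * xo s t + MCP s t * en s t + RTP s t * rt s t)
     - (inv_cost d i (xc s) + (\<Sum>t=1..horizon d. prod_cost d i (en s t + rt s t)))"

definition total_profit :: "('i::finite) gep_data \<Rightarrow> 'i profile \<Rightarrow> real" where
  "total_profit d x = (\<Sum>i\<in>UNIV. profit d i (x i))"

text \<open>The choices available to company \<open>i\<close> when the other companies play as in \<open>x\<close>:\<close>

definition admissible :: "('i::finite) gep_data \<Rightarrow> 'i profile \<Rightarrow> 'i \<Rightarrow> choice \<Rightarrow> bool" where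
  "admissible d x i s \<longleftrightarrow>
     operational d i s \<and> price_relations d (x(i := s)) i \<and> consistent_prices d (x(i := s)) i"

definition equilibrium :: "('i::finite) gep_data \<Rightarrow> 'i profile \<Rightarrow> bool" where
  "equilibrium d x \<longleftrightarrow>
     x \<in> F2 d \<and> (\<forall>i. is_arg_max (profit d i) (admissible d x i) (x i))"

end

theory Submission
  imports Defs
begin

text \<open>
  The game is an exact potential game, with total profit as its potential. A company's profit
  depends on its own component only, its conjectured prices included, so the total profit is
  separable: a unilateral deviation changes it by exactly the deviator's own change in profit.
  What remains is that such a deviation stays within the joint feasible set, although
  \<open>admissible\<close> imposes the price relations on the deviator only, and the deviator's quantities
  enter the right-hand sides of everybody's price relations
  (\<open>F2_unilateral_deviation\<close>). Price consistency settles this. The prices prescribed by the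
  relations are the same for all companies; if the deviator's conjectures agree both with the
  prescribed prices and with everybody else's conjectures, then every company's conjectures are the
  prescribed ones. Hence a profitable admissible deviation from a maximizer of total profit would
  be a jointly feasible profile with larger total profit.
\<close>

text \<open>
  The right-hand sides of the price relations do not mention the company, so along equal
  conjectures the relations pass from one company to any other.
\<close>

lemma price_relations_transfer:
  assumes "price_relations d x i" and "consistent_prices d x i"
  shows "price_relations d x j"
proof -
  have "Pr (x j) t = Pr (x i) t \<and> MCP (x j) t = MCP (x i) t \<and> RTP (x j) t = RTP (x i) t"
    if "t \<in> {1..horizon d}" for t
    using assms(2) that unfolding consistent_prices_def prod.inject by metis
  then show ?thesis
    using assms(1) by (simp add: price_relations_def)
qed

lemma consistent_prices_transfer:
  assumes "consistent_prices d x i"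
  shows "consistent_prices d x j"
  using assms unfolding consistent_prices_def by metis

lemma F2_unilateral_deviation:
  assumes "x \<in> F2 d" and "admissible d x i s"
  shows "x(i := s) \<in> F2 d"
proof -
  have "operational d j ((x(i := s)) j)" for j
    using assms by (simp add: F2_def admissible_def)
  moreover have "price_relations d (x(i := s)) j" and "consistent_prices d (x(i := s)) j" for j
    using assms(2) unfolding admissible_def
    by (blast intro: price_relations_transfer consistent_prices_transfer)+
  ultimately show ?thesis
    by (simp add: F2_def)
qed

lemma F2_imp_admissible:
  assumes "x \<in> F2 d"
  shows "admissible d x i (x i)"
  using assms by (simp add: F2_def admissible_def)

text \<open>
  Every other company's profit is a function of its own, unchanged component, so only the
  deviator's summand changes.
\<close>

lemma total_profit_unilateral_deviation:
  "total_profit d (x(i := s)) - total_profit d x = profit d i s - profit d i (x i)"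
  by (simp add: total_profit_def sum.remove[of UNIV i])

theorem corollaryV2:
  fixes d :: "('i::finite) gep_data" and x :: "'i profile"
  assumes "is_arg_max (total_profit d) (\<lambda>y. y \<in> F2 d) x"
  shows "equilibrium d x"
proof -
  have x: "x \<in> F2 d"
    and max: "\<And>y. y \<in> F2 d \<Longrightarrow> total_profit d y \<le> total_profit d x"
    using assms by (auto simp: is_arg_max_linorder)
  have "profit d i s \<le> profit d i (x i)" if "admissible d x i s" for i s
    using max[OF F2_unilateral_deviation[OF x that]] total_profit_unilateral_deviation[of d x i s]
    by simp
  then show ?thesis
    using x by (simp add: equilibrium_def is_arg_max_linorder F2_imp_admissible)
qed

end
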